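(* Let $k,m\ge 1$ and, for $n\ge 1$, let $\mathcal{H}_{n,k}^m$ be the hyperplane arrangement in $$\{(x_1,\dots,x_n,y_1^{(1)},\dots,y_1^{(k)},\dots,y_n^{(1)},\dots,y_n^{(k)})\mid x_i,y_j^{(\ell)}\in\mathbb{C}\}=\mathbb{C}^{nk+n}$$ given by $$\mathcal{H}_{n,k}^m=\{x_i-\omega^{p}x_j=y_i^{(\ell)}\mid 1\le i<j\le n,\ 0\le p\le m-1,\ 1\le \ell\le k\}\cup\{x_i=y_i^{(\ell)}\mid 1\le i\le n,\ 1\le \ell\le k\},$$ where $\omega=e^{2\pi \sqrt{-1}/m}$. Then $$\sum_{n\geq 1}\chi_{\mathcal{L}(\mathcal{H}_{n,k}^m)}(t)\,u^{n-1} = \sum_{n\geq 1}\frac{(t-1)_{n-1,m}\left((t-1)_{n,m}\right)^k u^{n-1}}{\prod_{i=0}^{n-1}\left(1-(im+1)(t-(im+1))^k u\right)},$$ where $(x)_{n,m}=x(x-m)\cdots(x-(n-1)m)$.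
   Context: The identity is one of formal power series in $u$ with coefficients in $\mathbb{Z}[t]$; $(x)_{0,m}=1$. $\mathcal{L}(\mathcal{H})$ is the intersection poset of the arrangement $\mathcal{H}$: all intersections of hyperplanes of $\mathcal{H}$ (including the whole space), ordered by reverse inclusion. For a finite ranked poset $P$ with bottom $\hat 0$, the characteristic polynomial is $\chi_P(t)=\sum_{X\in P}\mu_P(\hat 0,X)\,t^{\mathrm{rk}(P)-\mathrm{rk}(X)}$, where $\mu_P$ is the Möbius function and $\mathrm{rk}(P)$ is the length of $P$. *)

theory Defs
  imports Complex_Main "HOL-Library.FuncSet"
    "HOL-Computational_Algebra.Polynomial" "HOL-Computational_Algebra.Formal_Power_Series"
begin

text \<open>
  A poset is a reflexive, transitive and antisymmetric relation \<open>r\<close> on its carrier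
  \<^term>\<open>Field r\<close>, where \<^term>\<open>(x, y) \<in> r\<close> means that \<open>x\<close> is below \<open>y\<close>.
  The Moebius function is set to \<open>0\<close> off the order relation and when \<open>r\<close> is not a finite poset.
\<close>

function moebius :: "'a rel \<Rightarrow> 'a \<Rightarrow> 'a \<Rightarrow> int" where
  "moebius r x y =
    (if finite (Field r) \<and> Partial_order r \<and> (x, y) \<in> r
     then if x = y then 1
          else - (\<Sum>z \<in> {z. (x, z) \<in> r \<and> (z, y) \<in> r \<and> z \<noteq> y}. moebius r x z)
     else 0)"
  by pat_completeness auto
termination
proof (relation "measure (\<lambda>(r, x, y). card (under r y))", goal_cases)
  case 1
  show ?case by simp
next
  case (2 r x y z)
  then have fin: "finite (Field r)" and po: "Partial_order r"
    and zy: "(z, y) \<in> r" "z \<noteq> y" by auto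
  from po have tr: "trans r" and anti: "antisym r" and rf: "Refl r"
    by (auto simp: partial_order_on_def preorder_on_def)
  have "under r z \<subseteq> under r y"
    using zy(1) tr by (auto simp: under_def dest: transD)
  moreover have "y \<in> under r y"
    using zy(1) rf by (auto simp: under_def refl_on_def intro: FieldI2)
  moreover have "y \<notin> under r z"
    using zy anti by (auto simp: under_def dest: antisymD)
  ultimately have "under r z \<subset> under r y" by blast
  moreover have "finite (under r y)"
    by (rule finite_subset[OF _ fin]) (auto simp: under_def intro: FieldI1)
  ultimately show ?case by (simp add: psubset_card_mono)
qed

declare moebius.simps [simp del]

definition poset_bot :: "'a rel \<Rightarrow> 'a" where
  "poset_bot r = (THE b. b \<in> Field r \<and> (\<forall>x \<in> Field r. (b, x) \<in> r))"

text \<open>The length of a finite poset: a chain with \<open>c\<close> elements has length \<open>c - 1\<close>.\<close>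

definition poset_length :: "'a rel \<Rightarrow> nat" where
  "poset_length r = Max ((\<lambda>C. card C - 1) ` Chains r)"

text \<open>The rank of \<open>x\<close> is the length of the interval from the bottom element to \<open>x\<close>.\<close>

definition poset_rank :: "'a rel \<Rightarrow> 'a \<Rightarrow> nat" where
  "poset_rank r x = poset_length (Restr r (under r x))"

definition char_poly_poset :: "'a rel \<Rightarrow> int poly" where
  "char_poly_poset r =
    (\<Sum>x \<in> Field r. monom (moebius r (poset_bot r) x) (poset_length r - poset_rank r x))"

text \<open>All intersections of members of \<open>H\<close>, reversely ordered by inclusion; the empty
  intersection is the ambient space \<open>V\<close>.\<close>

definition intersections :: "'a set \<Rightarrow> 'a set set \<Rightarrow> 'a set set" where
  "intersections V H = {V \<inter> \<Inter>A | A. A \<subseteq> H}"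

definition intersection_poset :: "'a set \<Rightarrow> 'a set set \<Rightarrow> 'a set rel" where
  "intersection_poset V H =
    {(X, Y). X \<in> intersections V H \<and> Y \<in> intersections V H \<and> Y \<subseteq> X}"

lemma Field_intersection_poset: "Field (intersection_poset V H) = intersections V H"
  by (auto simp: Field_def intersection_poset_def)

lemma Partial_order_intersection_poset: "Partial_order (intersection_poset V H)"
  unfolding partial_order_on_def preorder_on_def Field_intersection_poset
  by (auto simp: refl_on_def trans_def antisym_def intersection_poset_def)

lemma finite_intersections: "finite H \<Longrightarrow> finite (intersections V H)"
  unfolding intersections_def by simp

lemma poset_bot_intersection_poset: "poset_bot (intersection_poset V H) = V"
  unfolding poset_bot_def Field_intersection_poset
proof (rule the_equality)
  have V: "V \<in> intersections V H"
    unfolding intersections_def by (rule CollectI, rule exI[of _ "{}"]) simp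
  then show "V \<in> intersections V H \<and>
      (\<forall>X \<in> intersections V H. (V, X) \<in> intersection_poset V H)"
    by (auto simp: intersection_poset_def intersections_def)
  show "b = V" if "b \<in> intersections V H \<and>
      (\<forall>X \<in> intersections V H. (b, X) \<in> intersection_poset V H)" for b
  proof
    from that show "b \<subseteq> V" by (auto simp: intersections_def)
    from that V show "V \<subseteq> b" by (auto simp: intersection_poset_def)
  qed
qed

text \<open>A point of \<open>\<complex>\<^bsup>nk+n\<^esup>\<close> is a pair \<open>(x, y)\<close> of coordinate families, where
  \<open>x i\<close> stands for \<open>x\<^sub>i\<close> and \<open>y (i, l)\<close> for \<open>y\<^sub>i\<^bsup>(l)\<^esup>\<close>, with
  \<open>1 \<le> i \<le> n\<close> and \<open>1 \<le> l \<le> k\<close>.\<close>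

type_synonym point = "(nat \<Rightarrow> complex) \<times> (nat \<times> nat \<Rightarrow> complex)"

definition ambient :: "nat \<Rightarrow> nat \<Rightarrow> point set" where
  "ambient n k = ({1..n} \<rightarrow>\<^sub>E UNIV) \<times> ({1..n} \<times> {1..k} \<rightarrow>\<^sub>E UNIV)"

definition arrangement :: "nat \<Rightarrow> nat \<Rightarrow> nat \<Rightarrow> point set set" where
  "arrangement n k m =
    {{(x, y) \<in> ambient n k. x i - exp (2 * of_real pi * \<i> / of_nat m) ^ p * x j = y (i, l)}
       | i j p l. 1 \<le> i \<and> i < j \<and> j \<le> n \<and> p \<le> m - 1 \<and> 1 \<le> l \<and> l \<le> k}
    \<union> {{(x, y) \<in> ambient n k. x i = y (i, l)} | i l. 1 \<le> i \<and> i \<le> n \<and> 1 \<le> l \<and> l \<le> k}"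

definition arrangement_char_poly :: "nat \<Rightarrow> nat \<Rightarrow> nat \<Rightarrow> int poly" where
  "arrangement_char_poly n k m =
    char_poly_poset (intersection_poset (ambient n k) (arrangement n k m))"

definition step_falling :: "'a::comm_ring_1 \<Rightarrow> nat \<Rightarrow> nat \<Rightarrow> 'a" where
  "step_falling x n m = (\<Prod>i<n. x - of_nat (i * m))"

text \<open>In \<open>\<int>[t][[u]]\<close>, with \<open>t\<close> written \<^term>\<open>[:0, 1:]\<close> and \<open>u\<close> written \<^term>\<open>fps_X\<close>. The coefficients do not form a field,
  so the quotient by a power series with constant coefficient \<open>1\<close> is the product with its
  inverse \<^term>\<open>fps_right_inverse f 1\<close>.\<close>

definition rhs_numerator :: "nat \<Rightarrow> nat \<Rightarrow> nat \<Rightarrow> int poly fps" where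
  "rhs_numerator n k m =
    fps_const (step_falling ([:0, 1:] - 1) (n - 1) m * step_falling ([:0, 1:] - 1) n m ^ k)
      * fps_X ^ (n - 1)"

definition rhs_denominator :: "nat \<Rightarrow> nat \<Rightarrow> nat \<Rightarrow> int poly fps" where
  "rhs_denominator n k m =
    (\<Prod>i = 0..n - 1.
      1 - fps_const (of_nat (i * m + 1) * ([:0, 1:] - of_nat (i * m + 1)) ^ k) * fps_X)"

lemma rhs_denominator_inverse:
  "rhs_denominator n k m * fps_right_inverse (rhs_denominator n k m) 1 = 1"
proof (rule fps_right_inverse)
  have "fps_nth (\<Prod>i\<in>A. 1 - fps_const (c i) * fps_X) 0 = 1" if "finite A" for A and c :: "nat \<Rightarrow> int poly"
    using that by induction auto
  then show "fps_nth (rhs_denominator n k m) 0 * 1 = 1"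
    by (simp add: rhs_denominator_def)
qed

end

theory Submission
  imports Defs
begin

text \<open>
  In the coordinates \<open>x\<^sub>i\<close> and \<open>z\<^sub>i\<^bsup>(l)\<^esup> = x\<^sub>i - y\<^sub>i\<^bsup>(l)\<^esup>\<close> the hyperplanes become \<open>z\<^sub>i\<^bsup>(l)\<^esup> = 0\<close> and
  \<open>z\<^sub>i\<^bsup>(l)\<^esup> = \<omega>\<^sup>p x\<^sub>j\<close> with \<open>i < j\<close>: each one kills a coordinate or identifies two coordinates up to
  an \<open>m\<close>-th root of unity. Hence every intersection \<open>X\<close> has a set of \<open>d\<close> free coordinates such that each
  coordinate is either zero on \<open>X\<close> or a root of unity times a free one.
  
  This permits a version of the finite field method over the complex numbers. Take a finite set
  \<open>S\<close> of complex numbers that contains 0 and is closed under multiplication by \<open>m\<close>-th roots of unity;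
  such a set has \<open>q = 1 + s m\<close> elements, and every \<open>s\<close> occurs. An intersection with \<open>d\<close> free coordinates
  contains exactly \<open>q\<^sup>d\<close> points all of whose coordinates lie in \<open>S\<close>, so Moebius inversion turns the
  characteristic polynomial at \<open>q\<close> into the number of such points on no hyperplane
  (\<open>poly_char_poly_counts_complement\<close>, \<open>poly_char_poly_counts_grid\<close>). All hyperplanes meet in a line,
  which accounts for one extra factor \<open>q\<close>.
  
  For the count, choose \<open>x\<^sub>n, x\<^bsub>n-1\<^esub>, \<dots>, x\<^sub>1\<close> in this order. Before \<open>x\<^sub>i\<close> is chosen, the forbidden values for
  \<open>z\<^sub>i\<^bsup>(l)\<^esup>\<close> are 0 and the orbits of the \<open>x\<^sub>j\<close>, \<open>j > i\<close>, so there are \<open>r m + 1\<close> of them if \<open>r\<close> nonzero orbits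
  have occurred. This leaves \<open>(q - (r m + 1))\<^sup>k\<close> choices for \<open>z\<^sub>i\<close>, while \<open>r m + 1\<close> choices of \<open>x\<^sub>i\<close> keep \<open>r\<close> and the
  other \<open>q - (r m + 1)\<close> increase it by one. The count is thus a sum of weighted lattice paths
  (\<open>path_weight\<close>, \<open>weighted_count\<close>). The paths that end at \<open>r\<close> have a rational generating function with one
  geometric factor for each level \<open>0, \<dots>, r\<close> (\<open>fps_nth_path_gf\<close>). The last choice, of \<open>x\<^sub>1\<close>, has the same
  total weight \<open>q\<close> from every state. It cancels the factor \<open>q\<close> of the common line, and what remains is
  \<open>(q - (r m + 1))\<^sup>k\<close> times a path of \<open>n - 1\<close> steps that ends at \<open>r\<close>, which is the summand with index
  \<open>r + 1\<close> on the right-hand side. Both sides of the resulting identity are polynomials in \<open>q\<close> that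
  agree for infinitely many \<open>q\<close>.
\<close>

section \<open>Intersection posets graded by a dimension function\<close>

text \<open>
  Here \<open>d\<close> plays the role of the dimension. Linear algebra enters only through the property that
  a hyperplane either contains an intersection or lowers its dimension by exactly one.
\<close>

locale graded_intersections =
  fixes V :: "'a set" and H :: "'a set set" and d :: "'a set \<Rightarrow> nat"
  assumes finite_H: "finite H"
    and proper: "h \<in> H \<Longrightarrow> \<not> V \<subseteq> h"
    and step: "X \<in> intersections V H \<Longrightarrow> h \<in> H \<Longrightarrow> X \<inter> h = X \<or> d X = Suc (d (X \<inter> h))"
begin

abbreviation "L \<equiv> intersections V H"
abbreviation "R \<equiv> intersection_poset V H"

lemma whole_in_intersections: "V \<in> L"
  unfolding intersections_def by (rule CollectI, rule exI[of _ "{}"]) simp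

lemma Inter_in_intersections: "A \<subseteq> H \<Longrightarrow> X \<in> L \<Longrightarrow> X \<inter> \<Inter>A \<in> L"
proof -
  assume A: "A \<subseteq> H" and "X \<in> L"
  then obtain B where "B \<subseteq> H" "X = V \<inter> \<Inter>B" by (auto simp: intersections_def)
  then have "X \<inter> \<Inter>A = V \<inter> \<Inter>(B \<union> A)" "B \<union> A \<subseteq> H" using A by auto
  then show ?thesis unfolding intersections_def by blast
qed

lemma centre_in_intersections: "V \<inter> \<Inter>H \<in> L"
  using Inter_in_intersections[of H V] whole_in_intersections by simp

lemma centre_le: "X \<in> L \<Longrightarrow> V \<inter> \<Inter>H \<subseteq> X"
  by (auto simp: intersections_def)

lemma dim_Inter:
  assumes "X \<in> L" "A \<subseteq> H"
  shows "X \<inter> \<Inter>A = X \<or> d (X \<inter> \<Inter>A) < d X"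
proof -
  have "finite A" using assms(2) finite_H by (rule finite_subset)
  then show ?thesis using assms(2)
  proof induction
    case (insert h A)
    have eq: "X \<inter> \<Inter>(insert h A) = (X \<inter> \<Inter>A) \<inter> h" by auto
    have "X \<inter> \<Inter>A \<in> L" using Inter_in_intersections assms(1) insert.prems by auto
    from step[OF this, of h] insert show ?case unfolding eq by fastforce
  qed simp
qed

lemma dim_strict_mono:
  assumes "X \<in> L" "Y \<in> L" "Y \<subset> X"
  shows "d Y < d X"
proof -
  obtain A where A: "A \<subseteq> H" "Y = V \<inter> \<Inter>A" using assms(2) by (auto simp: intersections_def)
  have "X \<subseteq> V" using assms(1) by (auto simp: intersections_def)
  then have "Y = X \<inter> \<Inter>A" using A assms(3) by auto
  then show ?thesis using dim_Inter[OF assms(1) A(1)] assms(3) by auto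
qed

lemma dim_mono: "X \<in> L \<Longrightarrow> Y \<in> L \<Longrightarrow> Y \<subseteq> X \<Longrightarrow> d Y \<le> d X"
  using dim_strict_mono[of X Y] by (cases "X = Y") (auto simp: psubset_eq)

text \<open>
  Intersecting with the members of \<open>A\<close> one at a time lowers the dimension by at most one in each
  step, so the chain of the distinct partial intersections passes through every dimension.
\<close>

lemma long_chain:
  assumes "A \<subseteq> H"
  shows "\<exists>C \<in> Chains R. finite C \<and> (\<forall>Y\<in>C. V \<inter> \<Inter>A \<subseteq> Y) \<and> V \<inter> \<Inter>A \<in> C
           \<and> card C = Suc (d V - d (V \<inter> \<Inter>A))"
proof -
  have "finite A" using assms finite_H by (rule finite_subset)
  then show ?thesis using assms
  proof induction
    case empty
    show ?case
      by (rule bexI[of _ "{V}"])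
        (use whole_in_intersections in \<open>auto simp: Chains_def intersection_poset_def\<close>)
  next
    case (insert h A)
    define X where "X = V \<inter> \<Inter>A"
    have eq: "V \<inter> \<Inter>(insert h A) = X \<inter> h" by (auto simp: X_def)
    have X: "X \<in> L" using Inter_in_intersections[of A V] whole_in_intersections insert.prems
      by (auto simp: X_def)
    have Xh: "X \<inter> h \<in> L"
      using Inter_in_intersections[of "insert h A" V] whole_in_intersections insert.prems eq by simp
    obtain C where C: "C \<in> Chains R" "finite C" "\<forall>Y\<in>C. X \<subseteq> Y" "X \<in> C"
      "card C = Suc (d V - d X)" using insert unfolding X_def[symmetric] by auto
    show ?case
    proof (cases "X \<inter> h = X")
      case True
      then show ?thesis using C unfolding eq by auto
    next
      case False
      then have dX: "d X = Suc (d (X \<inter> h))" using step[OF X] insert.prems by auto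
      have "d X \<le> d V"
        by (rule dim_mono) (use X whole_in_intersections in \<open>auto simp: X_def\<close>)
      moreover have "X \<inter> h \<notin> C" using C(3) False by auto
      moreover have "insert (X \<inter> h) C \<in> Chains R"
        using C(1,3) Xh by (force simp: Chains_def intersection_poset_def)
      ultimately show ?thesis unfolding eq using C dX
        by (intro bexI[of _ "insert (X \<inter> h) C"]) auto
    qed
  qed
qed

text \<open>
  A longer chain than the one above is impossible, since dimensions strictly decrease along a chain
  and stay between those of \<open>X\<close> and \<open>V\<close>.
\<close>

lemma poset_rank_eq:
  assumes X: "X \<in> L"
  shows "poset_rank R X = d V - d X"
proof -
  let ?Q = "Restr R (under R X)"
  have chain: "card C - 1 \<le> d V - d X" if C: "C \<in> Chains ?Q" for C
  proof -
    have sub: "Y \<in> L \<and> X \<subseteq> Y \<and> Y \<subseteq> V" if "Y \<in> C" for Y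
      using C that unfolding Chains_def under_def intersection_poset_def
      by (fastforce simp: intersections_def)
    have "inj_on d C"
    proof (rule inj_onI)
      fix Y Z assume YZ: "Y \<in> C" "Z \<in> C" "d Y = d Z"
      then have "Y \<subseteq> Z \<or> Z \<subseteq> Y" using C by (auto simp: Chains_def intersection_poset_def)
      then show "Y = Z" using YZ dim_strict_mono sub by (metis less_irrefl psubsetI)
    qed
    moreover have "d ` C \<subseteq> {d X..d V}"
      by (simp add: image_subset_iff dim_mono sub X whole_in_intersections)
    ultimately have "card C \<le> card {d X..d V}"
      by (intro card_inj_on_le[of d]) auto
    then show ?thesis by auto
  qed
  have fin: "finite (Chains ?Q)"
  proof (rule finite_subset)
    show "Chains ?Q \<subseteq> Pow L"
      by (auto simp: Chains_def intersection_poset_def)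
    show "finite (Pow L)" using finite_intersections[OF finite_H] by simp
  qed
  obtain A where A: "A \<subseteq> H" "X = V \<inter> \<Inter>A" using X by (auto simp: intersections_def)
  from long_chain[OF A(1)] obtain C where C: "C \<in> Chains R" "\<forall>Y\<in>C. X \<subseteq> Y"
    "card C = Suc (d V - d X)" unfolding A(2)[symmetric] by auto
  have "C \<in> Chains ?Q"
    using C(1,2) X unfolding Chains_def under_def intersection_poset_def by auto
  then have "d V - d X \<in> (\<lambda>C. card C - 1) ` Chains ?Q"
    using C(3) by force
  then show ?thesis unfolding poset_rank_def poset_length_def
    by (intro Max_eqI) (use fin chain in auto)
qed

lemma poset_length_eq: "poset_length R = d V - d (V \<inter> \<Inter>H)"
proof -
  have "under R (V \<inter> \<Inter>H) = L"
    using centre_in_intersections centre_le by (auto simp: under_def intersection_poset_def)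
  then have "Restr R (under R (V \<inter> \<Inter>H)) = R"
    by (auto simp: intersection_poset_def)
  then show ?thesis
    using poset_rank_eq[OF centre_in_intersections] by (simp add: poset_rank_def)
qed

text \<open>
  The recursion that defines the Moebius function of the intersection poset, in the form in which it
  is summed over the intersections that contain a given point.
\<close>

lemma sum_moebius_below:
  assumes Y: "Y \<in> L"
  shows "(\<Sum>X | X \<in> L \<and> Y \<subseteq> X. moebius R V X) = (if Y = V then 1 else 0)"
proof -
  have fin: "finite L" by (rule finite_intersections[OF finite_H])
  have below: "X \<subseteq> V" if "X \<in> L" for X using that by (auto simp: intersections_def)
  have *: "finite (Field R) \<and> Partial_order R \<and> (V, Y) \<in> R"
    using Y below whole_in_intersections fin Partial_order_intersection_poset[of V H]
    unfolding Field_intersection_poset by (simp add: intersection_poset_def)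
  show ?thesis
  proof (cases "Y = V")
    case True
    then have "{X. X \<in> L \<and> Y \<subseteq> X} = {V}" using below whole_in_intersections by auto
    then show ?thesis using * True by (simp add: moebius.simps[of R V V])
  next
    case False
    have "{X. X \<in> L \<and> Y \<subseteq> X} = insert Y {Z. (V, Z) \<in> R \<and> (Z, Y) \<in> R \<and> Z \<noteq> Y}" (is "_ = insert Y ?Z")
      using Y below whole_in_intersections by (auto simp: intersection_poset_def)
    moreover have "finite ?Z"
      by (rule finite_subset[OF _ fin]) (auto simp: intersection_poset_def)
    ultimately show ?thesis
      using False * by (simp add: moebius.simps[of R V Y])
  qed
qed

text \<open>
  If \<open>T\<close> meets each intersection in \<open>q\<close> to the power of its dimension, then the power of \<open>q\<close> attached to
  \<open>X\<close> is a number of points of \<open>X \<inter> T\<close>. Exchanging the two sums leaves, for each point \<open>p\<close>, the sum of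
  the Moebius function over all intersections containing \<open>p\<close>, which vanishes unless \<open>p\<close> avoids all
  hyperplanes. The factor \<open>q\<close> to the dimension of the centre appears because the characteristic
  polynomial is normalised by rank instead of dimension.
\<close>

theorem poly_char_poly_counts_complement:
  fixes q :: nat
  assumes fin: "finite T" and TV: "T \<subseteq> V"
    and count: "\<And>X. X \<in> L \<Longrightarrow> card (X \<inter> T) = q ^ d X"
  shows "poly (char_poly_poset R) (int q) * int q ^ d (V \<inter> \<Inter>H) = int (card (T - \<Union>H))"
proof -
  have finL: "finite L" by (rule finite_intersections[OF finite_H])
  have expo: "(poset_length R - poset_rank R X) + d (V \<inter> \<Inter>H) = d X" if X: "X \<in> L" for X
  proof -
    have "d X \<le> d V" using X whole_in_intersections
      by (intro dim_mono) (auto simp: intersections_def)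
    moreover have "d (V \<inter> \<Inter>H) \<le> d X"
      using X centre_in_intersections centre_le by (intro dim_mono) auto
    ultimately show ?thesis by (simp add: poset_length_eq poset_rank_eq[OF X])
  qed
  have inner: "(\<Sum>X\<in>L. if p \<in> X then moebius R V X else 0) = (if p \<notin> \<Union>H then 1 else 0)"
    if p: "p \<in> T" for p
  proof -
    \<comment> \<open>the smallest intersection that contains \<open>p\<close>\<close>
    let ?Y = "V \<inter> \<Inter>{h \<in> H. p \<in> h}"
    have pV: "p \<in> V" using p TV by auto
    have Y: "?Y \<in> L" using Inter_in_intersections[of _ V] whole_in_intersections by auto
    have "p \<in> X \<longleftrightarrow> ?Y \<subseteq> X" if "X \<in> L" for X
      using that pV unfolding intersections_def by blast
    then have set: "{X \<in> L. p \<in> X} = {X. X \<in> L \<and> ?Y \<subseteq> X}" by blast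
    have whole: "?Y = V \<longleftrightarrow> p \<notin> \<Union>H"
    proof
      assume "p \<notin> \<Union>H"
      then have none: "{h \<in> H. p \<in> h} = {}" by auto
      show "?Y = V" unfolding none by simp
    next
      assume eq: "?Y = V"
      show "p \<notin> \<Union>H"
      proof
        assume "p \<in> \<Union>H"
        then obtain h where h: "h \<in> H" "p \<in> h" by auto
        then have "V \<subseteq> h" using eq by auto
        then show False using h proper by auto
      qed
    qed
    have "(\<Sum>X\<in>L. if p \<in> X then moebius R V X else 0) = (\<Sum>X | X \<in> L \<and> p \<in> X. moebius R V X)"
      by (simp add: sum.inter_filter[OF finL])
    also have "\<dots> = (if p \<notin> \<Union>H then 1 else 0)"
      using sum_moebius_below[OF Y] set whole by simp
    finally show ?thesis .
  qed
  have "poly (char_poly_poset R) (int q) * int q ^ d (V \<inter> \<Inter>H)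
      = (\<Sum>X\<in>L. moebius R V X * int q ^ d X)"
    unfolding char_poly_poset_def poset_bot_intersection_poset Field_intersection_poset poly_sum
      sum_distrib_right
    by (rule sum.cong) (simp_all add: poly_monom mult.assoc flip: power_add expo)
  also have "\<dots> = (\<Sum>X\<in>L. \<Sum>p\<in>T. if p \<in> X then moebius R V X else 0)"
  proof (rule sum.cong[OF refl])
    fix X assume X: "X \<in> L"
    have "int q ^ d X = int (card {p \<in> T. p \<in> X})"
      using count[OF X] by (simp add: Int_def conj_commute)
    then show "moebius R V X * int q ^ d X = (\<Sum>p\<in>T. if p \<in> X then moebius R V X else 0)"
      using fin by (simp add: flip: sum.inter_filter)
  qed
  also have "\<dots> = (\<Sum>p\<in>T. \<Sum>X\<in>L. if p \<in> X then moebius R V X else 0)"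
    by (rule sum.swap)
  also have "\<dots> = (\<Sum>p\<in>T. if p \<notin> \<Union>H then 1 else 0)"
    by (intro sum.cong refl inner)
  also have "\<dots> = int (card (T - \<Union>H))"
    using fin by (simp add: set_diff_eq flip: sum.inter_filter)
  finally show ?thesis .
qed

end

section \<open>Finite sets of complex numbers closed under roots of unity\<close>

definition roots_of_unity :: "nat \<Rightarrow> complex set" where
  "roots_of_unity m = {z. z ^ m = 1}"

lemma one_root: "1 \<in> roots_of_unity m"
  by (simp add: roots_of_unity_def)

lemma root_mult: "a \<in> roots_of_unity m \<Longrightarrow> b \<in> roots_of_unity m \<Longrightarrow> a * b \<in> roots_of_unity m"
  by (simp add: roots_of_unity_def power_mult_distrib)

lemma root_divide: "a \<in> roots_of_unity m \<Longrightarrow> b \<in> roots_of_unity m \<Longrightarrow> a / b \<in> roots_of_unity m"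
  by (simp add: roots_of_unity_def power_divide)

lemma root_nonzero: "m \<ge> 1 \<Longrightarrow> a \<in> roots_of_unity m \<Longrightarrow> a \<noteq> 0"
  by (auto simp: roots_of_unity_def power_0_left)

lemma card_roots: "m \<ge> 1 \<Longrightarrow> card (roots_of_unity m) = m"
  unfolding roots_of_unity_def by (rule card_roots_unity_eq) simp

lemma finite_roots: "m \<ge> 1 \<Longrightarrow> finite (roots_of_unity m)"
  using card_roots[of m] by (intro card_ge_0_finite) simp

lemma powers_root_of_unity:
  assumes "m \<ge> 1"
  shows "(\<lambda>p. exp (2 * of_real pi * \<i> / of_nat m) ^ p) ` {..m - 1} = roots_of_unity m"
proof -
  have "exp (2 * of_real pi * \<i> / of_nat m) ^ p = cis (2 * pi * real p / real m)" for p
    by (simp add: cis_conv_exp mult_ac flip: exp_of_nat_mult)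
  moreover have "{..m - 1} = {..<m}" using assms by auto
  ultimately show ?thesis
    using bij_betw_roots_unity[of m] assms by (simp add: bij_betw_def roots_of_unity_def)
qed

text \<open>
  These sets replace a finite field of \<open>q \<equiv> 1\<close> modulo \<open>m\<close> elements: they keep the zero and the action of
  the \<open>m\<close>-th roots of unity, which is free on the nonzero elements.
\<close>

definition unity_closed :: "nat \<Rightarrow> complex set \<Rightarrow> bool" where
  "unity_closed m S \<longleftrightarrow> finite S \<and> 0 \<in> S \<and> (\<forall>a\<in>roots_of_unity m. \<forall>z\<in>S. a * z \<in> S)"

lemma unity_closed_add_orbit:
  assumes m: "m \<ge> 1" and S: "unity_closed m S"
  shows "unity_closed m (S \<union> (\<lambda>a. a * z) ` roots_of_unity m)"
    and "z \<in> S \<Longrightarrow> S \<union> (\<lambda>a. a * z) ` roots_of_unity m = S"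
    and "z \<notin> S \<Longrightarrow> card (S \<union> (\<lambda>a. a * z) ` roots_of_unity m) = card S + m"
proof -
  let ?O = "(\<lambda>a. a * z) ` roots_of_unity m"
  have "b * (a * z) \<in> ?O" if "a \<in> roots_of_unity m" "b \<in> roots_of_unity m" for a b
    using root_mult[OF that(2,1)] by (intro image_eqI[of _ _ "b * a"]) auto
  then show "unity_closed m (S \<union> ?O)"
    using S finite_roots[OF m] by (auto simp: unity_closed_def)
  show "S \<union> ?O = S" if "z \<in> S" using S that by (auto simp: unity_closed_def)
  show "card (S \<union> ?O) = card S + m" if z: "z \<notin> S"
  proof -
    have "z \<noteq> 0" using S z by (auto simp: unity_closed_def)
    then have "inj_on (\<lambda>a. a * z) (roots_of_unity m)" by (auto intro: inj_onI)
    then have "card ?O = m" using card_roots[OF m] by (simp add: card_image)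
    moreover have "a * z \<notin> S" if a: "a \<in> roots_of_unity m" for a
    proof
      assume az: "a * z \<in> S"
      \<comment> \<open>closed sets are also closed under division by a root of unity\<close>
      have "1 / a * (a * z) \<in> S"
        using S az root_divide[OF one_root a] unfolding unity_closed_def by blast
      then show False using z root_nonzero[OF m a] by simp
    qed
    then have "S \<inter> ?O = {}" by auto
    ultimately show ?thesis
      using S finite_roots[OF m] by (subst card_Un_disjoint) (auto simp: unity_closed_def)
  qed
qed

lemma ex_unity_closed:
  assumes m: "m \<ge> 1"
  shows "\<exists>S. unity_closed m S \<and> card S = 1 + s * m"
proof (induction s)
  case 0
  show ?case by (rule exI[of _ "{0}"]) (simp add: unity_closed_def)
next
  case (Suc s)
  then obtain S where S: "unity_closed m S" "card S = 1 + s * m" by auto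
  have "infinite (UNIV :: complex set)" by (rule infinite_UNIV_char_0)
  then obtain z where z: "z \<notin> S"
    using S(1) ex_new_if_finite unfolding unity_closed_def by blast
  show ?case
    using unity_closed_add_orbit(1)[OF m S(1), of z] unity_closed_add_orbit(3)[OF m S(1) z] S(2)
    by (intro exI[of _ "S \<union> (\<lambda>a. a * z) ` roots_of_unity m"]) simp
qed

section \<open>Arrangements that kill coordinates or identify them up to roots of unity\<close>

text \<open>
  The map \<open>coord\<close> is a system of coordinates on the ambient space, so that the points themselves may be
  of any type. The condition \<open>c \<noteq> e\<close> excludes equations that hold on the whole space.
\<close>

locale monomial_arrangement =
  fixes m :: nat and V :: "'p set" and C :: "'c set" and coord :: "'p \<Rightarrow> 'c \<Rightarrow> complex"
    and H :: "'p set set"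
  assumes m: "m \<ge> 1" and finite_C: "finite C" and finite_H: "finite H"
    and bij: "bij_betw coord V (C \<rightarrow>\<^sub>E UNIV)"
    and hyperplane: "h \<in> H \<Longrightarrow> (\<exists>c\<in>C. h = {p \<in> V. coord p c = 0}) \<or>
      (\<exists>c\<in>C. \<exists>e\<in>C. \<exists>a\<in>roots_of_unity m. c \<noteq> e \<and> h = {p \<in> V. coord p c = a * coord p e})"
begin

text \<open>
  Values on \<open>F\<close> can be prescribed freely on \<open>X\<close>, and they determine every other coordinate, either as
  zero or as a root of unity times one of them. So \<open>card F\<close> is the dimension of \<open>X\<close>.
\<close>

definition monomial_basis :: "'c set \<Rightarrow> 'p set \<Rightarrow> bool" where
  "monomial_basis F X \<longleftrightarrow> X \<subseteq> V \<and> F \<subseteq> C \<and> (\<forall>u. \<exists>p\<in>X. \<forall>f\<in>F. coord p f = u f) \<and>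
    (\<forall>c\<in>C. (\<forall>p\<in>X. coord p c = 0) \<or>
      (\<exists>f\<in>F. \<exists>a\<in>roots_of_unity m. \<forall>p\<in>X. coord p c = a * coord p f))"

lemma monomial_basis_coord:
  assumes "monomial_basis F X" "c \<in> C"
  obtains (zero) "\<forall>p\<in>X. coord p c = 0"
    | (multiple) f a where "f \<in> F" "a \<in> roots_of_unity m" "\<forall>p\<in>X. coord p c = a * coord p f"
  using assms unfolding monomial_basis_def by blast

lemma ex_point: "\<exists>p\<in>V. \<forall>c\<in>C. coord p c = u c"
proof -
  have "restrict u C \<in> coord ` V" using bij by (auto simp: bij_betw_def)
  then obtain p where p: "p \<in> V" "restrict u C = coord p" by auto
  then have "\<forall>c\<in>C. coord p c = u c" by (metis restrict_apply')
  then show ?thesis using p(1) by auto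
qed

lemma point_eqI:
  assumes "p \<in> V" "p' \<in> V" "\<And>c. c \<in> C \<Longrightarrow> coord p c = coord p' c"
  shows "p = p'"
proof -
  have "coord p \<in> C \<rightarrow>\<^sub>E UNIV" "coord p' \<in> C \<rightarrow>\<^sub>E UNIV"
    using assms bij by (auto simp: bij_betw_def)
  then have "coord p = coord p'" using assms(3) by (rule PiE_ext)
  then show ?thesis using assms bij by (auto simp: bij_betw_def dest: inj_onD)
qed

lemma monomial_basis_whole: "monomial_basis C V"
  unfolding monomial_basis_def using ex_point one_root by fastforce

lemma monomial_basis_kill:
  assumes X: "monomial_basis F X" and f: "f \<in> F"
  shows "monomial_basis (F - {f}) (X \<inter> {p \<in> V. coord p f = 0})"
proof -
  have sub: "X \<subseteq> V" "F \<subseteq> C" using X by (auto simp: monomial_basis_def)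
  have "\<exists>p\<in>X \<inter> {p \<in> V. coord p f = 0}. \<forall>e\<in>F - {f}. coord p e = u e" for u
  proof -
    obtain p where p: "p \<in> X" "\<forall>e\<in>F. coord p e = (u(f := 0)) e"
      using X unfolding monomial_basis_def by blast
    then show ?thesis using f sub by (intro bexI[of _ p]) auto
  qed
  moreover have "(\<forall>p\<in>X \<inter> {p \<in> V. coord p f = 0}. coord p c = 0) \<or>
      (\<exists>e\<in>F - {f}. \<exists>a\<in>roots_of_unity m.
        \<forall>p\<in>X \<inter> {p \<in> V. coord p f = 0}. coord p c = a * coord p e)" if "c \<in> C" for c
    using X that
  proof (cases rule: monomial_basis_coord)
    case (multiple e a)
    then show ?thesis by (cases "e = f") auto
  qed auto
  ultimately show ?thesis using sub unfolding monomial_basis_def by blast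
qed

lemma monomial_basis_identify:
  assumes X: "monomial_basis F X" and f: "f \<in> F" "e \<in> F" "f \<noteq> e" and a: "a \<in> roots_of_unity m"
  shows "monomial_basis (F - {f}) (X \<inter> {p \<in> V. coord p f = a * coord p e})"
proof -
  let ?h = "{p \<in> V. coord p f = a * coord p e}"
  have sub: "X \<subseteq> V" "F \<subseteq> C" using X by (auto simp: monomial_basis_def)
  have "\<exists>p\<in>X \<inter> ?h. \<forall>g\<in>F - {f}. coord p g = u g" for u
  proof -
    obtain p where p: "p \<in> X" "\<forall>g\<in>F. coord p g = (u(f := a * u e)) g"
      using X unfolding monomial_basis_def by blast
    then show ?thesis using f sub by (intro bexI[of _ p]) auto
  qed
  moreover have "(\<forall>p\<in>X \<inter> ?h. coord p c = 0) \<or>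
      (\<exists>g\<in>F - {f}. \<exists>b\<in>roots_of_unity m. \<forall>p\<in>X \<inter> ?h. coord p c = b * coord p g)" if "c \<in> C" for c
    using X that
  proof (cases rule: monomial_basis_coord)
    case (multiple g b)
    show ?thesis
    proof (cases "g = f")
      case True
      then have "\<forall>p\<in>X \<inter> ?h. coord p c = (b * a) * coord p e" using multiple by auto
      then show ?thesis using root_mult[OF multiple(2) a] f by blast
    qed (use multiple in blast)
  qed auto
  ultimately show ?thesis using sub unfolding monomial_basis_def by blast
qed

lemma Int_Collect_eqI:
  "(\<And>p. p \<in> X \<Longrightarrow> P p \<longleftrightarrow> Q p) \<Longrightarrow> X \<inter> {p \<in> V. P p} = X \<inter> {p \<in> V. Q p}"
  by blast

lemma monomial_basis_coord_zero:
  assumes X: "monomial_basis F X" and c: "c \<in> C"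
  shows "X \<inter> {p \<in> V. coord p c = 0} = X \<or>
    (\<exists>f\<in>F. monomial_basis (F - {f}) (X \<inter> {p \<in> V. coord p c = 0}))"
  using X c
proof (cases rule: monomial_basis_coord)
  case zero
  then show ?thesis using X by (auto simp: monomial_basis_def)
next
  case (multiple f a)
  then have "X \<inter> {p \<in> V. coord p c = 0} = X \<inter> {p \<in> V. coord p f = 0}"
    using root_nonzero[OF m multiple(2)] by (intro Int_Collect_eqI) simp
  then show ?thesis using monomial_basis_kill[OF X multiple(1)] multiple(1) by auto
qed

text \<open>
  Written in free coordinates \<open>f\<close> and \<open>g\<close>, the equation of a hyperplane is trivial on \<open>X\<close>, or kills a free
  coordinate, or has the form \<open>f = r g\<close> with a root of unity \<open>r\<close>. In the last case \<open>f\<close> is eliminated if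
  \<open>f\<close> and \<open>g\<close> differ; if they coincide the equation is trivial for \<open>r = 1\<close> and kills \<open>f\<close> otherwise.
\<close>

lemma monomial_basis_hyperplane:
  assumes X: "monomial_basis F X" and h: "h \<in> H"
  shows "X \<inter> h = X \<or> (\<exists>f\<in>F. monomial_basis (F - {f}) (X \<inter> h))"
proof -
  have XV: "X \<subseteq> V" using X by (auto simp: monomial_basis_def)
  from hyperplane[OF h] consider (zero) c where "c \<in> C" "h = {p \<in> V. coord p c = 0}"
    | (eq) c e a where "c \<in> C" "e \<in> C" "a \<in> roots_of_unity m"
        "h = {p \<in> V. coord p c = a * coord p e}" by blast
  then show ?thesis
  proof cases
    case zero
    then show ?thesis using monomial_basis_coord_zero[OF X] by blast
  next
    case eq
    have a0: "a \<noteq> 0" using root_nonzero[OF m eq(3)] .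
    show ?thesis using X eq(1)
    proof (cases rule: monomial_basis_coord)
      case zero
      then have "X \<inter> h = X \<inter> {p \<in> V. coord p e = 0}" unfolding eq(4)
        by (intro Int_Collect_eqI) (use a0 zero in simp)
      then show ?thesis using monomial_basis_coord_zero[OF X eq(2)] by simp
    next
      case c: (multiple f b)
      have b0: "b \<noteq> 0" using root_nonzero[OF m c(2)] .
      show ?thesis using X eq(2)
      proof (cases rule: monomial_basis_coord)
        case zero
        then have "X \<inter> h = X \<inter> {p \<in> V. coord p f = 0}" unfolding eq(4)
          by (intro Int_Collect_eqI) (use b0 zero c(3) in simp)
        then show ?thesis using monomial_basis_kill[OF X c(1)] c(1) by metis
      next
        case e: (multiple g b')
        define r where "r = a * b' / b"
        have r: "r \<in> roots_of_unity m"
          unfolding r_def by (intro root_divide root_mult eq(3) e(2) c(2))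
        have Xh: "X \<inter> h = X \<inter> {p \<in> V. coord p f = r * coord p g}"
          unfolding eq(4)
        proof (rule Int_Collect_eqI)
          fix p assume "p \<in> X"
          then have "coord p c = b * coord p f" "coord p e = b' * coord p g" using c(3) e(3) by auto
          then show "coord p c = a * coord p e \<longleftrightarrow> coord p f = r * coord p g"
            using b0 by (simp only: r_def) (simp add: field_simps)
        qed
        show ?thesis
        proof (cases "f = g")
          case False
          then show ?thesis
            unfolding Xh using monomial_basis_identify[OF X c(1) e(1) False r] c(1) by blast
        next
          case fg: True
          show ?thesis
          proof (cases "r = 1")
            case True
            then show ?thesis unfolding Xh fg using XV by auto
          next
            case False
            then have "X \<inter> h = X \<inter> {p \<in> V. coord p f = 0}"
              unfolding Xh fg by (intro Int_Collect_eqI) simp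
            then show ?thesis using monomial_basis_kill[OF X c(1)] c(1) by metis
          qed
        qed
      qed
    qed
  qed
qed

lemma ex_monomial_basis:
  assumes "X \<in> intersections V H"
  shows "\<exists>F. monomial_basis F X"
proof -
  have "\<exists>F. monomial_basis F (V \<inter> \<Inter>A)" if "A \<subseteq> H" for A
  proof -
    have "finite A" using that finite_H by (rule finite_subset)
    then show ?thesis using that
    proof induction
      case empty
      show ?case using monomial_basis_whole by auto
    next
      case (insert h A)
      then obtain F where F: "monomial_basis F (V \<inter> \<Inter>A)" by auto
      have "V \<inter> \<Inter>(insert h A) = V \<inter> \<Inter>A \<inter> h" by auto
      then show ?case using monomial_basis_hyperplane[OF F, of h] F insert.prems by auto
    qed
  qed
  then show ?thesis using assms by (auto simp: intersections_def)
qed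

definition grid :: "complex set \<Rightarrow> 'p set" where
  "grid S = {p \<in> V. \<forall>c\<in>C. coord p c \<in> S}"

text \<open>
  A point of \<open>X\<close> lies on the grid as soon as its free coordinates lie in \<open>S\<close>, because \<open>S\<close> contains zero and
  is closed under roots of unity.
\<close>

lemma card_grid_Int:
  assumes X: "monomial_basis F X" and S: "unity_closed m S"
  shows "card (X \<inter> grid S) = card S ^ card F"
proof -
  have sub: "X \<subseteq> V" "F \<subseteq> C" using X by (auto simp: monomial_basis_def)
  have "bij_betw (\<lambda>p. restrict (coord p) F) (X \<inter> grid S) (F \<rightarrow>\<^sub>E S)"
    unfolding bij_betw_def
  proof
    show "inj_on (\<lambda>p. restrict (coord p) F) (X \<inter> grid S)"
    proof (rule inj_onI)
      fix p p' assume p: "p \<in> X \<inter> grid S" "p' \<in> X \<inter> grid S"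
        and eq: "restrict (coord p) F = restrict (coord p') F"
      have eqF: "coord p f = coord p' f" if "f \<in> F" for f
        using eq that by (metis restrict_apply')
      show "p = p'"
      proof (rule point_eqI)
        show "coord p c = coord p' c" if "c \<in> C" for c
          using X that by (cases rule: monomial_basis_coord) (use p eqF in auto)
      qed (use p sub in auto)
    qed
    show "(\<lambda>p. restrict (coord p) F) ` (X \<inter> grid S) = F \<rightarrow>\<^sub>E S"
    proof
      show "(\<lambda>p. restrict (coord p) F) ` (X \<inter> grid S) \<subseteq> F \<rightarrow>\<^sub>E S"
        using sub by (auto simp: grid_def)
      show "F \<rightarrow>\<^sub>E S \<subseteq> (\<lambda>p. restrict (coord p) F) ` (X \<inter> grid S)"
      proof
        fix u assume u: "u \<in> F \<rightarrow>\<^sub>E S"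
        obtain p where p: "p \<in> X" "\<forall>f\<in>F. coord p f = u f"
          using X unfolding monomial_basis_def by blast
        have "coord p c \<in> S" if "c \<in> C" for c
          using X that
        proof (cases rule: monomial_basis_coord)
          case (multiple f a)
          then have "coord p c = a * u f" "u f \<in> S" using p u by auto
          then show ?thesis using S multiple(2) by (simp add: unity_closed_def)
        qed (use p S in \<open>simp add: unity_closed_def\<close>)
        then have "p \<in> X \<inter> grid S" using p sub by (auto simp: grid_def)
        moreover have "u = restrict (coord p) F"
        proof
          fix f
          show "u f = restrict (coord p) F f"
            using p(2) PiE_arb[OF u, of f] by (cases "f \<in> F") simp_all
        qed
        ultimately show "u \<in> (\<lambda>p. restrict (coord p) F) ` (X \<inter> grid S)" by blast
      qed
    qed
  qed
  then have "card (X \<inter> grid S) = card (F \<rightarrow>\<^sub>E S)" by (rule bij_betw_same_card)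
  also have "\<dots> = card S ^ card F"
    using finite_subset[OF sub(2) finite_C] by (simp add: card_PiE)
  finally show ?thesis .
qed

definition free_dim :: "'p set \<Rightarrow> nat" where
  "free_dim X = card (SOME F. monomial_basis F X)"

text \<open>
  Any two monomial bases have the same size, since counting grid points over a set \<open>S\<close> with at least two
  elements recovers the exponent.
\<close>

lemma free_dim_eq:
  assumes F: "monomial_basis F X"
  shows "free_dim X = card F"
proof -
  obtain S where S: "unity_closed m S" "card S = 1 + 1 * m" using ex_unity_closed[OF m] by blast
  have F': "monomial_basis (SOME F. monomial_basis F X) X" using F by (rule someI)
  have "card S ^ card F = card S ^ free_dim X"
    using card_grid_Int[OF F S(1)] card_grid_Int[OF F' S(1)] by (simp add: free_dim_def)
  then show ?thesis using S(2) m by simp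
qed

lemma card_Int_grid:
  assumes "X \<in> intersections V H" "unity_closed m S"
  shows "card (X \<inter> grid S) = card S ^ free_dim X"
  using ex_monomial_basis[OF assms(1)] card_grid_Int[OF _ assms(2)] free_dim_eq by metis

sublocale graded_intersections V H free_dim
proof
  show "finite H" by (rule finite_H)
  show "\<not> V \<subseteq> h" if "h \<in> H" for h
  proof -
    from hyperplane[OF that] obtain c where c: "c \<in> C" "h = {p \<in> V. coord p c = 0} \<or>
        (\<exists>e\<in>C. \<exists>a. c \<noteq> e \<and> h = {p \<in> V. coord p c = a * coord p e})" by blast
    obtain p where "p \<in> V" "\<forall>e\<in>C. coord p e = (if e = c then 1 else 0)"
      using ex_point[of "\<lambda>e. if e = c then 1 else 0"] by blast
    then have "p \<in> V - h" using c by auto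
    then show ?thesis by auto
  qed
  show "X \<inter> h = X \<or> free_dim X = Suc (free_dim (X \<inter> h))"
    if "X \<in> intersections V H" "h \<in> H" for X h
  proof -
    from ex_monomial_basis[OF that(1)] obtain F where F: "monomial_basis F X" ..
    have "finite F" using F finite_C by (auto simp: monomial_basis_def intro: finite_subset)
    then have "card F = Suc (card (F - {f}))" if "f \<in> F" for f
      using that by (metis card.remove)
    then show ?thesis
      using monomial_basis_hyperplane[OF F that(2)] free_dim_eq[OF F] free_dim_eq by metis
  qed
qed

text \<open>
  The second factor on the left is the number of grid points on the intersection of all hyperplanes.
\<close>

theorem poly_char_poly_counts_grid:
  assumes S: "unity_closed m S"
  shows "poly (char_poly_poset (intersection_poset V H)) (int (card S)) * 
      int (card (V \<inter> \<Inter>H \<inter> grid S)) = int (card (grid S - \<Union>H))"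
proof -
  have fin: "finite (grid S)"
  proof -
    have "V \<inter> grid S = grid S" by (auto simp: grid_def)
    then have "card (grid S) = card S ^ card C"
      using card_grid_Int[OF monomial_basis_whole S] by simp
    moreover have "card S > 0" using S by (auto simp: unity_closed_def card_gt_0_iff)
    ultimately show ?thesis by (intro card_ge_0_finite) simp
  qed
  have "grid S \<subseteq> V" by (auto simp: grid_def)
  from poly_char_poly_counts_complement[OF fin this card_Int_grid[OF _ S]]
  show ?thesis unfolding card_Int_grid[OF centre_in_intersections S] of_nat_power .
qed

end

section \<open>Weighted lattice paths and the count over a finite set\<close>

text \<open>
  The total weight of the paths of \<open>N\<close> steps that start at level 0 and end at level \<open>r\<close>. With
  \<open>c = r m + 1\<close>, a step that stays at level \<open>r\<close> has weight \<open>c (t - c)\<^sup>k\<close>, and a step from \<open>r\<close> to \<open>r + 1\<close> has weight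
  \<open>(t - c)\<^bsup>k+1\<^esup>\<close>. The definition looks at the last step.
\<close>

fun path_weight :: "nat \<Rightarrow> nat \<Rightarrow> 'a::comm_ring_1 \<Rightarrow> nat \<Rightarrow> nat \<Rightarrow> 'a" where
  "path_weight k m t 0 r = (if r = 0 then 1 else 0)"
| "path_weight k m t (Suc N) r =
    of_nat (r * m + 1) * (t - of_nat (r * m + 1)) ^ k * path_weight k m t N r +
    (if r = 0 then 0 else (t - of_nat ((r - 1) * m + 1)) ^ Suc k * path_weight k m t N (r - 1))"

lemma path_weight_eq_0: "N < r \<Longrightarrow> path_weight k m t N r = 0"
  by (induction N arbitrary: r) auto

lemma poly_path_weight: "poly (path_weight k m p N r) x = path_weight k m (poly p x) N r"
  by (induction N arbitrary: r) auto

text \<open>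
  The dual recursion: the last step is moved from the weights to the test function \<open>\<phi>\<close>.
\<close>

lemma sum_path_weight_Suc:
  fixes t :: "'a::comm_ring_1"
  shows "(\<Sum>r\<le>Suc N. path_weight k m t (Suc N) r * \<phi> r) =
    (\<Sum>r\<le>N. path_weight k m t N r * ((t - of_nat (r * m + 1)) ^ k *
      (of_nat (r * m + 1) * \<phi> r + (t - of_nat (r * m + 1)) * \<phi> (Suc r))))"
proof -
  let ?c = "\<lambda>r. of_nat (r * m + 1) :: 'a" and ?P = "path_weight k m t N"
  have stay: "(\<Sum>r\<le>Suc N. ?c r * (t - ?c r) ^ k * ?P r * \<phi> r) = (\<Sum>r\<le>N. ?c r * (t - ?c r) ^ k * ?P r * \<phi> r)"
    using path_weight_eq_0[of N "Suc N" k m t] by simp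
  have move: "(\<Sum>r\<le>Suc N. (if r = 0 then 0 else (t - ?c (r - 1)) ^ Suc k * ?P (r - 1)) * \<phi> r)
      = (\<Sum>r\<le>N. (t - ?c r) ^ Suc k * ?P r * \<phi> (Suc r))"
    by (subst sum.atMost_Suc_shift) simp
  have "(\<Sum>r\<le>Suc N. path_weight k m t (Suc N) r * \<phi> r) =
      (\<Sum>r\<le>Suc N. ?c r * (t - ?c r) ^ k * ?P r * \<phi> r) +
      (\<Sum>r\<le>Suc N. (if r = 0 then 0 else (t - ?c (r - 1)) ^ Suc k * ?P (r - 1)) * \<phi> r)"
    unfolding path_weight.simps distrib_right sum.distrib ..
  also have "\<dots> = (\<Sum>r\<le>N. ?P r * ((t - ?c r) ^ k * (?c r * \<phi> r + (t - ?c r) * \<phi> (Suc r))))"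
    unfolding stay move sum.distrib[symmetric] by (rule sum.cong) (simp_all only: power_Suc ring_distribs ac_simps)
  finally show ?thesis .
qed

text \<open>
  The values that \<open>z\<^sub>i\<close> has to avoid, when \<open>I\<close> consists of the indices above \<open>i\<close>.
\<close>

definition unity_multiples :: "nat \<Rightarrow> (nat \<Rightarrow> complex) \<Rightarrow> nat set \<Rightarrow> complex set" where
  "unity_multiples m x I = insert 0 (\<Union>j\<in>I. (\<lambda>a. a * x j) ` roots_of_unity m)"

lemma unity_multiples_insert:
  "unity_multiples m x (insert i I) = unity_multiples m x I \<union> (\<lambda>a. a * x i) ` roots_of_unity m"
  by (auto simp: unity_multiples_def)

lemma unity_closed_multiples:
  assumes m: "m \<ge> 1" and "finite I"
  shows "unity_closed m (unity_multiples m x I)"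
  using assms(2)
proof induction
  case empty
  show ?case by (simp add: unity_multiples_def unity_closed_def)
qed (simp add: unity_multiples_insert unity_closed_add_orbit(1)[OF m])

lemma unity_multiples_subset:
  "unity_closed m S \<Longrightarrow> (\<And>i. i \<in> I \<Longrightarrow> x i \<in> S) \<Longrightarrow> unity_multiples m x I \<subseteq> S"
  by (auto simp: unity_multiples_def unity_closed_def)

lemma unity_multiples_cong:
  "(\<And>i. i \<in> I \<Longrightarrow> x i = x' i) \<Longrightarrow> unity_multiples m x I = unity_multiples m x' I"
  by (auto simp: unity_multiples_def)

text \<open>
  A new value \<open>z\<close> lies in \<open>M\<close> and changes nothing, or adds a full orbit of \<open>m\<close> elements.
\<close>

lemma sum_add_orbit:
  fixes \<phi> :: "nat \<Rightarrow> int"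
  assumes m: "m \<ge> 1" and S: "unity_closed m S" and M: "unity_closed m M" "M \<subseteq> S"
  shows "(\<Sum>z\<in>S. \<phi> (card (M \<union> (\<lambda>a. a * z) ` roots_of_unity m))) =
    int (card M) * \<phi> (card M) + (int (card S) - int (card M)) * \<phi> (card M + m)"
proof -
  have fin: "finite S" using S by (simp add: unity_closed_def)
  have "(\<Sum>z\<in>S. \<phi> (card (M \<union> (\<lambda>a. a * z) ` roots_of_unity m))) =
      (\<Sum>z\<in>S - M. \<phi> (card M + m)) + (\<Sum>z\<in>M. \<phi> (card M))"
    unfolding sum.subset_diff[OF M(2) fin]
    by (intro arg_cong2[where f = "(+)"] sum.cong)
      (simp_all add: unity_closed_add_orbit(2,3)[OF m M(1)])
  also have "int (card (S - M)) = int (card S) - int (card M)"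
    using card_Diff_subset[of M S] M(2) fin card_mono[OF fin M(2)] finite_subset[OF M(2) fin] by simp
  then have "(\<Sum>z\<in>S - M. \<phi> (card M + m)) = (int (card S) - int (card M)) * \<phi> (card M + m)" by simp
  finally show ?thesis by simp
qed

lemma sum_PiE_insert:
  assumes "i \<notin> I"
  shows "(\<Sum>x\<in>insert i I \<rightarrow>\<^sub>E S. F x) = (\<Sum>x\<in>I \<rightarrow>\<^sub>E S. \<Sum>z\<in>S. F (x(i := z)))"
proof -
  have inj: "inj_on (\<lambda>(z, x). x(i := z)) (S \<times> (I \<rightarrow>\<^sub>E S))"
    using inj_combinator[OF assms, of "\<lambda>_. S"] by simp
  have "(\<Sum>x\<in>insert i I \<rightarrow>\<^sub>E S. F x) = (\<Sum>(z, x)\<in>S \<times> (I \<rightarrow>\<^sub>E S). F (x(i := z)))"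
    unfolding PiE_insert_eq sum.reindex[OF inj] by (simp add: case_prod_beta)
  also have "\<dots> = (\<Sum>x\<in>I \<rightarrow>\<^sub>E S. \<Sum>z\<in>S. F (x(i := z)))"
    by (simp add: sum.cartesian_product[symmetric] sum.swap[of _ S])
  finally show ?thesis .
qed

text \<open>
  Induction on the number \<open>N\<close> of coordinates, removing the one with the smallest index. That coordinate
  occurs in no factor of the product, only in the argument of \<open>\<phi>\<close>, so summing over it replaces \<open>\<phi>\<close> by the
  function \<open>\<psi>\<close> of the remaining coordinates; this is why \<open>\<phi>\<close> has to be arbitrary. The number of forbidden
  values is always of the form \<open>r m + 1\<close>, and \<open>sum_path_weight_Suc\<close> describes the same transfer on paths.
\<close>

lemma weighted_count:
  fixes \<phi> :: "nat \<Rightarrow> int"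
  assumes m: "m \<ge> 1" and S: "unity_closed m S" and "a + N = b"
  shows "(\<Sum>x\<in>{a..<b} \<rightarrow>\<^sub>E S.
      (\<Prod>i\<in>{a..<b}. (int (card S) - int (card (unity_multiples m x {Suc i..<b}))) ^ k) *
      \<phi> (card (unity_multiples m x {a..<b}))) =
    (\<Sum>r\<le>N. path_weight k m (int (card S)) N r * \<phi> (r * m + 1))"
  using assms(3)
proof (induction N arbitrary: a \<phi>)
  case 0
  then show ?case by (simp add: unity_multiples_def)
next
  case (Suc N)
  let ?q = "int (card S)"
  let ?I = "{Suc a..<b}"
  let ?M = "\<lambda>x I. unity_multiples m x I"
  let ?W = "\<lambda>x. \<Prod>i\<in>?I. (?q - int (card (?M x {Suc i..<b}))) ^ k"
  define \<psi> where "\<psi> c = (?q - int c) ^ k * (int c * \<phi> c + (?q - int c) * \<phi> (c + m))" for c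
  have I: "{a..<b} = insert a ?I" using Suc.prems by auto
  have summand: "(\<Prod>i\<in>{a..<b}. (?q - int (card (?M (x(a := z)) {Suc i..<b}))) ^ k) *
      \<phi> (card (?M (x(a := z)) {a..<b})) =
      ?W x * (?q - int (card (?M x ?I))) ^ k *
        \<phi> (card (?M x ?I \<union> (\<lambda>c. c * z) ` roots_of_unity m))" for x z
  proof -
    have tail: "?M (x(a := z)) {Suc i..<b} = ?M x {Suc i..<b}" if "a \<le> i" for i
      by (rule unity_multiples_cong) (use that in auto)
    have "?M (x(a := z)) {a..<b} = ?M x ?I \<union> (\<lambda>c. c * z) ` roots_of_unity m"
      unfolding I unity_multiples_insert using tail[of a] by simp
    moreover have "(\<Prod>i\<in>{a..<b}. (?q - int (card (?M (x(a := z)) {Suc i..<b}))) ^ k) =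
        (\<Prod>i\<in>{a..<b}. (?q - int (card (?M x {Suc i..<b}))) ^ k)"
      using tail by (intro prod.cong) auto
    ultimately show ?thesis unfolding I by (simp add: mult_ac)
  qed
  have "(\<Sum>x\<in>{a..<b} \<rightarrow>\<^sub>E S.
      (\<Prod>i\<in>{a..<b}. (?q - int (card (?M x {Suc i..<b}))) ^ k) * \<phi> (card (?M x {a..<b})))
    = (\<Sum>x\<in>insert a ?I \<rightarrow>\<^sub>E S.
      (\<Prod>i\<in>{a..<b}. (?q - int (card (?M x {Suc i..<b}))) ^ k) * \<phi> (card (?M x {a..<b})))"
    using I by simp
  also have "\<dots> = (\<Sum>x\<in>?I \<rightarrow>\<^sub>E S. \<Sum>z\<in>S. ?W x * (?q - int (card (?M x ?I))) ^ k *
        \<phi> (card (?M x ?I \<union> (\<lambda>c. c * z) ` roots_of_unity m)))"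
    unfolding summand[symmetric] by (rule sum_PiE_insert) simp
  also have "\<dots> = (\<Sum>x\<in>?I \<rightarrow>\<^sub>E S. ?W x * \<psi> (card (?M x ?I)))"
  proof (rule sum.cong[OF refl])
    fix x assume x: "x \<in> ?I \<rightarrow>\<^sub>E S"
    have M: "unity_closed m (?M x ?I)" "?M x ?I \<subseteq> S"
      by (rule unity_closed_multiples[OF m], simp)
        (rule unity_multiples_subset[OF S], rule PiE_mem[OF x])
    show "(\<Sum>z\<in>S. ?W x * (?q - int (card (?M x ?I))) ^ k *
        \<phi> (card (?M x ?I \<union> (\<lambda>c. c * z) ` roots_of_unity m))) = ?W x * \<psi> (card (?M x ?I))"
      unfolding sum_distrib_left[symmetric] sum_add_orbit[OF m S M] \<psi>_def by (simp add: mult.assoc)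
  qed
  also have "\<dots> = (\<Sum>r\<le>N. path_weight k m ?q N r * \<psi> (r * m + 1))"
    by (rule Suc.IH) (use Suc.prems in simp)
  also have "\<dots> = (\<Sum>r\<le>Suc N. path_weight k m ?q (Suc N) r * \<phi> (r * m + 1))"
    unfolding sum_path_weight_Suc[of k m ?q N "\<lambda>r. \<phi> (r * m + 1)"] \<psi>_def
    by (simp add: algebra_simps)
  finally show ?case .
qed

text \<open>
  With the constant test function 1 the last step contributes \<open>c + (q - c) = q\<close>, whatever
  \<open>c = r m + 1\<close> is.
\<close>

lemma total_weighted_count:
  assumes m: "m \<ge> 1" and S: "unity_closed m S"
  shows "(\<Sum>x\<in>{1..Suc N} \<rightarrow>\<^sub>E S.
      \<Prod>i\<in>{1..Suc N}. (int (card S) - int (card (unity_multiples m x {i<..Suc N}))) ^ k) =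
    int (card S) * (\<Sum>r\<le>N. path_weight k m (int (card S)) N r * (int (card S) - int (r * m + 1)) ^ k)"
proof -
  have I: "{1..Suc N} = {1..<Suc (Suc N)}" "\<And>i. {i<..Suc N} = {Suc i..<Suc (Suc N)}" by auto
  show ?thesis
    using weighted_count[OF m S, of 1 "Suc N" "Suc (Suc N)" k "\<lambda>_. 1"]
      sum_path_weight_Suc[of k m "int (card S)" N "\<lambda>_. 1"]
    unfolding I by (simp add: sum_distrib_left mult_ac)
qed

section \<open>The arrangement in the new coordinates\<close>

text \<open>
  The pair \<open>(i, 0)\<close> indexes the coordinate \<open>x\<^sub>i\<close>, and \<open>(i, l)\<close> with \<open>l \<ge> 1\<close> the coordinate
  \<open>x\<^sub>i - y\<^sub>i\<^bsup>(l)\<^esup>\<close>.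
\<close>

definition coords :: "nat \<Rightarrow> nat \<Rightarrow> point \<Rightarrow> nat \<times> nat \<Rightarrow> complex" where
  "coords n k p = restrict (\<lambda>(i, l). if l = 0 then fst p i else fst p i - snd p (i, l)) ({1..n} \<times> {0..k})"

lemma coords_simps:
  assumes "i \<in> {1..n}"
  shows "coords n k p (i, 0) = fst p i"
    and "l \<in> {1..k} \<Longrightarrow> coords n k p (i, l) = fst p i - snd p (i, l)"
  using assms by (auto simp: coords_def)

lemma bij_betw_coords:
  "bij_betw (coords n k) (ambient n k) ({1..n} \<times> {0..k} \<rightarrow>\<^sub>E UNIV)"
proof (rule bij_betw_byWitness)
  let ?inv = "\<lambda>v. (restrict (\<lambda>i. v (i, 0)) {1..n},
    restrict (\<lambda>(i, l). v (i, 0) - v (i, l)) ({1..n} \<times> {1..k}))"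
  show "\<forall>p\<in>ambient n k. ?inv (coords n k p) = p"
    by (auto simp: ambient_def coords_def fun_eq_iff PiE_def extensional_def)
  show "\<forall>v\<in>{1..n} \<times> {0..k} \<rightarrow>\<^sub>E UNIV. coords n k (?inv v) = v"
    by (auto simp: coords_def fun_eq_iff PiE_def extensional_def)
  show "coords n k ` ambient n k \<subseteq> {1..n} \<times> {0..k} \<rightarrow>\<^sub>E UNIV"
    unfolding coords_def by (intro image_subsetI restrict_PiE_iff[THEN iffD2]) simp
  show "?inv ` ({1..n} \<times> {0..k} \<rightarrow>\<^sub>E UNIV) \<subseteq> ambient n k"
    unfolding ambient_def by (intro image_subsetI SigmaI restrict_PiE_iff[THEN iffD2]) simp_all
qed

text \<open>
  The powers \<open>\<omega>\<^sup>p\<close> with \<open>p \<le> m - 1\<close> run through all \<open>m\<close>-th roots of unity, so they enter only as a set.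
\<close>

lemma arrangement_eq:
  assumes "m \<ge> 1"
  shows "arrangement n k m = (\<Union>i\<in>{1..n}. \<Union>l\<in>{1..k}.
    insert {p \<in> ambient n k. coords n k p (i, l) = 0}
      ((\<lambda>(j, a). {p \<in> ambient n k. coords n k p (i, l) = a * coords n k p (j, 0)}) `
        ({i<..n} \<times> roots_of_unity m)))" (is "_ = ?R")
proof -
  let ?w = "exp (2 * of_real pi * \<i> / of_nat m)"
  have diff: "{(x, y) \<in> ambient n k. x i - a * x j = y (i, l)} =
      {p \<in> ambient n k. coords n k p (i, l) = a * coords n k p (j, 0)}"
    if "1 \<le> i" "i < j" "j \<le> n" "1 \<le> l" "l \<le> k" for i j l a
    using that by (auto simp: coords_simps algebra_simps)
  have zero: "{(x, y) \<in> ambient n k. x i = y (i, l)} = {p \<in> ambient n k. coords n k p (i, l) = 0}"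
    if "1 \<le> i" "i \<le> n" "1 \<le> l" "l \<le> k" for i l
    using that by (auto simp: coords_simps)
  have root: "?w ^ p \<in> roots_of_unity m" if "p \<le> m - 1" for p
    using powers_root_of_unity[OF assms] that by blast
  have power: "\<exists>p\<le>m - 1. a = ?w ^ p" if "a \<in> roots_of_unity m" for a
    using powers_root_of_unity[OF assms] that by blast
  show ?thesis
  proof
    show "arrangement n k m \<subseteq> ?R"
    proof
      fix h assume "h \<in> arrangement n k m"
      then consider
        (diff) i j p l where "1 \<le> i" "i < j" "j \<le> n" "p \<le> m - 1" "1 \<le> l" "l \<le> k"
          "h = {(x, y) \<in> ambient n k. x i - ?w ^ p * x j = y (i, l)}"
        | (zero) i l where "1 \<le> i" "i \<le> n" "1 \<le> l" "l \<le> k"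
          "h = {(x, y) \<in> ambient n k. x i = y (i, l)}"
        unfolding arrangement_def by blast
      then show "h \<in> ?R"
      proof cases
        case d: diff
        have "h = (\<lambda>(j, a). {p \<in> ambient n k. coords n k p (i, l) = a * coords n k p (j, 0)}) (j, ?w ^ p)"
          using d diff by simp
        moreover have "(j, ?w ^ p) \<in> {i<..n} \<times> roots_of_unity m" using d root by simp
        moreover have "i \<in> {1..n}" "l \<in> {1..k}" using d by auto
        ultimately show ?thesis by blast
      next
        case z: zero
        then have "i \<in> {1..n}" "l \<in> {1..k}" by auto
        then show ?thesis unfolding z(5) zero[OF z(1-4)] by blast
      qed
    qed
    show "?R \<subseteq> arrangement n k m"
    proof
      fix h assume "h \<in> ?R"
      then consider
        (diff) i j a l where "1 \<le> i" "i < j" "j \<le> n" "a \<in> roots_of_unity m" "1 \<le> l" "l \<le> k"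
          "h = {p \<in> ambient n k. coords n k p (i, l) = a * coords n k p (j, 0)}"
        | (zero) i l where "1 \<le> i" "i \<le> n" "1 \<le> l" "l \<le> k"
          "h = {p \<in> ambient n k. coords n k p (i, l) = 0}"
        by auto
      then show "h \<in> arrangement n k m"
      proof cases
        case d: diff
        obtain p where p: "p \<le> m - 1" "a = ?w ^ p" using power[OF d(4)] by blast
        have "h = {(x, y) \<in> ambient n k. x i - ?w ^ p * x j = y (i, l)}"
          using d diff p by simp
        then show ?thesis unfolding arrangement_def using d p(1) by blast
      next
        case z: zero
        then have "h = {(x, y) \<in> ambient n k. x i = y (i, l)}" using zero by simp
        then show ?thesis unfolding arrangement_def using z by blast
      qed
    qed
  qed
qed

lemma monomial_arrangement_coords:
  assumes m: "m \<ge> 1"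
  shows "monomial_arrangement m (ambient n k) ({1..n} \<times> {0..k}) (coords n k) (arrangement n k m)"
proof
  show "finite (arrangement n k m)"
    unfolding arrangement_eq[OF m] using finite_roots[OF m] by (intro finite_UN_I finite.insertI finite_imageI) auto
  show "bij_betw (coords n k) (ambient n k) ({1..n} \<times> {0..k} \<rightarrow>\<^sub>E UNIV)"
    by (rule bij_betw_coords)
  fix h assume "h \<in> arrangement n k m"
  then show "(\<exists>c\<in>{1..n} \<times> {0..k}. h = {p \<in> ambient n k. coords n k p c = 0}) \<or>
    (\<exists>c\<in>{1..n} \<times> {0..k}. \<exists>e\<in>{1..n} \<times> {0..k}. \<exists>a\<in>roots_of_unity m.
      c \<noteq> e \<and> h = {p \<in> ambient n k. coords n k p c = a * coords n k p e})"
    unfolding arrangement_eq[OF m]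
  proof (elim UN_E insertE imageE)
    fix i l assume "i \<in> {1..n}" "l \<in> {1..k}" "h = {p \<in> ambient n k. coords n k p (i, l) = 0}"
    then show ?thesis by (intro disjI1 bexI[of _ "(i, l)"]) auto
  next
    fix i l ja assume il: "i \<in> {1..n}" "l \<in> {1..k}"
      and h: "h = (case ja of (j, a) \<Rightarrow> {p \<in> ambient n k. coords n k p (i, l) = a * coords n k p (j, 0)})"
      and ja: "ja \<in> {i<..n} \<times> roots_of_unity m"
    obtain j a where [simp]: "ja = (j, a)" by (cases ja)
    show ?thesis
      by (intro disjI2 bexI[of _ "(i, l)"] bexI[of _ "(j, 0)"] bexI[of _ a]) (use il h ja in auto)
  qed
qed (use m in auto)

context
  fixes n k m :: nat
  assumes m: "m \<ge> 1"
begin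

interpretation monomial_arrangement m "ambient n k" "{1..n} \<times> {0..k}" "coords n k" "arrangement n k m"
  by (rule monomial_arrangement_coords[OF m])

lemma mem_grid_iff:
  "p \<in> grid S \<longleftrightarrow> p \<in> ambient n k \<and> (\<forall>i\<in>{1..n}. fst p i \<in> S \<and> (\<forall>l\<in>{1..k}. fst p i - snd p (i, l) \<in> S))"
proof -
  have split: "{0..k} = insert 0 {1..k}" by auto
  have "(\<forall>c\<in>{1..n} \<times> {0..k}. coords n k p c \<in> S) \<longleftrightarrow>
      (\<forall>i\<in>{1..n}. fst p i \<in> S \<and> (\<forall>l\<in>{1..k}. fst p i - snd p (i, l) \<in> S))"
    unfolding split by (auto simp: coords_simps)
  then show ?thesis unfolding grid_def by blast
qed

lemma mem_Union_arrangement_iff: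
  assumes "p \<in> ambient n k"
  shows "p \<in> \<Union>(arrangement n k m) \<longleftrightarrow>
    (\<exists>i\<in>{1..n}. \<exists>l\<in>{1..k}. fst p i - snd p (i, l) \<in> unity_multiples m (fst p) {i<..n})"
proof -
  have "p \<in> \<Union>(arrangement n k m) \<longleftrightarrow> (\<exists>i\<in>{1..n}. \<exists>l\<in>{1..k}. coords n k p (i, l) = 0 \<or>
      (\<exists>j\<in>{i<..n}. \<exists>a\<in>roots_of_unity m. coords n k p (i, l) = a * coords n k p (j, 0)))"
    unfolding arrangement_eq[OF m] using assms by fastforce
  also have "\<dots> \<longleftrightarrow> (\<exists>i\<in>{1..n}. \<exists>l\<in>{1..k}.
      fst p i - snd p (i, l) \<in> unity_multiples m (fst p) {i<..n})"
    by (intro bex_cong refl) (auto simp: coords_simps unity_multiples_def)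
  finally show ?thesis .
qed

text \<open>
  Once \<open>x\<close> is fixed, the \<open>y\<^sub>i\<^bsup>(l)\<^esup>\<close> are chosen independently: \<open>x\<^sub>i - y\<^sub>i\<^bsup>(l)\<^esup>\<close> is any element of \<open>S\<close> outside the
  forbidden values, which depend on \<open>i\<close> but not on \<open>l\<close>.
\<close>

lemma card_grid_complement:
  assumes S: "unity_closed m S"
  shows "int (card (grid S - \<Union>(arrangement n k m))) = (\<Sum>x\<in>{1..n} \<rightarrow>\<^sub>E S.
    \<Prod>i\<in>{1..n}. (int (card S) - int (card (unity_multiples m x {i<..n}))) ^ k)"
proof -
  let ?M = "\<lambda>x i. unity_multiples m x {i<..n}"
  let ?Y = "\<lambda>x. \<Pi>\<^sub>E il\<in>{1..n} \<times> {1..k}. (\<lambda>z. x (fst il) - z) ` (S - ?M x (fst il))"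
  have finS: "finite S" using S by (simp add: unity_closed_def)
  have shift: "w \<in> (\<lambda>z. c - z) ` A \<longleftrightarrow> c - w \<in> A" for w c :: complex and A
    by (auto intro: image_eqI[of _ _ "c - w"])
  have "grid S - \<Union>(arrangement n k m) = (SIGMA x:{1..n} \<rightarrow>\<^sub>E S. ?Y x)"
  proof (rule set_eqI)
    fix p :: point
    obtain x y where p: "p = (x, y)" by (cases p)
    have "p \<in> grid S - \<Union>(arrangement n k m) \<longleftrightarrow> p \<in> ambient n k \<and>
        (\<forall>i\<in>{1..n}. x i \<in> S \<and> (\<forall>l\<in>{1..k}. x i - y (i, l) \<in> S - ?M x i))"
      using mem_grid_iff[of p S] mem_Union_arrangement_iff[of p] p by auto
    also have "\<dots> \<longleftrightarrow> p \<in> (SIGMA x:{1..n} \<rightarrow>\<^sub>E S. ?Y x)"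
      unfolding p ambient_def PiE_iff mem_Sigma_iff shift by auto
    finally show "p \<in> grid S - \<Union>(arrangement n k m) \<longleftrightarrow> p \<in> (SIGMA x:{1..n} \<rightarrow>\<^sub>E S. ?Y x)" .
  qed
  moreover have "int (card (?Y x)) = (\<Prod>i\<in>{1..n}. (int (card S) - int (card (?M x i))) ^ k)"
    if x: "x \<in> {1..n} \<rightarrow>\<^sub>E S" for x
  proof -
    have "card ((\<lambda>z. c - z) ` (S - ?M x i)) = card S - card (?M x i)" "card (?M x i) \<le> card S"
      if "i \<in> {1..n}" for i and c :: complex
    proof -
      have M: "?M x i \<subseteq> S" using x that by (intro unity_multiples_subset[OF S]) (auto simp: PiE_mem)
      show "card (?M x i) \<le> card S" by (rule card_mono[OF finS M])
      have "card ((\<lambda>z. c - z) ` (S - ?M x i)) = card (S - ?M x i)"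
        by (rule card_image) (auto intro: inj_onI)
      then show "card ((\<lambda>z. c - z) ` (S - ?M x i)) = card S - card (?M x i)"
        using card_Diff_subset[OF finite_subset[OF M finS] M] by simp
    qed
    then have "int (card (?Y x)) =
        (\<Prod>il\<in>{1..n} \<times> {1..k}. int (card S) - int (card (?M x (fst il))))"
      by (subst card_PiE) (auto simp: of_nat_diff intro!: prod.cong)
    also have "\<dots> = (\<Prod>i\<in>{1..n}. \<Prod>l\<in>{1..k}. int (card S) - int (card (?M x i)))"
      unfolding prod.cartesian_product by (rule prod.cong) auto
    finally show ?thesis by simp
  qed
  moreover have "finite (?Y x)" for x
    using finS by (intro finite_PiE) auto
  moreover have "finite ({1..n} \<rightarrow>\<^sub>E S)" using finS by (intro finite_PiE) auto
  ultimately show ?thesis by simp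
qed

text \<open>
  On all hyperplanes at once, \<open>y\<^sub>i\<^bsup>(l)\<^esup> = x\<^sub>i\<close> for all \<open>i\<close>, and then \<open>x\<^sub>j = 0\<close> for \<open>j > 1\<close>. Only \<open>x\<^sub>1\<close> remains free.
\<close>

lemma card_grid_centre:
  assumes n: "n \<ge> 1" and k: "k \<ge> 1" and S: "unity_closed m S"
  shows "card (ambient n k \<inter> \<Inter>(arrangement n k m) \<inter> grid S) = card S"
proof -
  let ?f = "\<lambda>a. (restrict (\<lambda>i. if i = 1 then a else 0) {1..n},
    restrict (\<lambda>(i, l). if i = 1 then a else 0) ({1..n} \<times> {1..k})) :: point"
  have "bij_betw ?f S (ambient n k \<inter> \<Inter>(arrangement n k m) \<inter> grid S)"
  proof (rule bij_betw_byWitness[where f' = "\<lambda>p. fst p 1"])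
    show "\<forall>a\<in>S. fst (?f a) 1 = a" using n by simp
    show "\<forall>p\<in>ambient n k \<inter> \<Inter>(arrangement n k m) \<inter> grid S. ?f (fst p 1) = p"
    proof
      fix p assume p: "p \<in> ambient n k \<inter> \<Inter>(arrangement n k m) \<inter> grid S"
      have y: "snd p (i, l) = fst p i" if il: "i \<in> {1..n}" "l \<in> {1..k}" for i l
      proof -
        have "p \<in> {p \<in> ambient n k. coords n k p (i, l) = 0}"
          using p il unfolding arrangement_eq[OF m] by blast
        then show ?thesis using il by (simp add: coords_simps)
      qed
      have x: "fst p j = 0" if j: "j \<in> {1..n}" "j \<noteq> 1" for j
      proof -
        have "(\<lambda>(j, a). {p \<in> ambient n k. coords n k p (1, 1) = a * coords n k p (j, 0)}) (j, 1)
            \<in> arrangement n k m"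
          unfolding arrangement_eq[OF m] using j n k one_root[of m]
          by (intro UN_I[of 1] insertI2 imageI) auto
        then have "p \<in> {p \<in> ambient n k. coords n k p (1, 1) = coords n k p (j, 0)}"
          using p by auto
        then show ?thesis using j n k y[of 1 1] by (simp add: coords_simps)
      qed
      obtain u v where uv: "p = (u, v)" by (cases p)
      have u: "u = restrict (\<lambda>i. if i = 1 then u 1 else 0) {1..n}"
        using x p by (auto simp: uv ambient_def PiE_def extensional_def)
      have v: "v = restrict (\<lambda>(i, l). if i = 1 then u 1 else 0) ({1..n} \<times> {1..k})"
        using x y p by (auto simp: uv ambient_def PiE_def extensional_def)
      show "?f (fst p 1) = p"
        unfolding uv fst_conv using u[symmetric] v[symmetric] by (rule arg_cong2[where f = Pair])
    qed
    show "?f ` S \<subseteq> ambient n k \<inter> \<Inter>(arrangement n k m) \<inter> grid S"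
    proof (intro image_subsetI IntI InterI)
      fix a assume a: "a \<in> S"
      show amb: "?f a \<in> ambient n k" by (auto simp: ambient_def)
      have "0 \<in> S" using S by (simp add: unity_closed_def)
      then show "?f a \<in> grid S" unfolding mem_grid_iff using amb a by auto
      fix h assume "h \<in> arrangement n k m"
      then show "?f a \<in> h"
        unfolding arrangement_eq[OF m] using amb by (auto simp: coords_simps)
    qed
    show "(\<lambda>p. fst p 1) ` (ambient n k \<inter> \<Inter>(arrangement n k m) \<inter> grid S) \<subseteq> S"
    proof -
      have "fst p 1 \<in> S" if "p \<in> grid S" for p using that n unfolding mem_grid_iff by auto
      then show ?thesis by blast
    qed
  qed
  then show ?thesis by (simp add: bij_betw_same_card)
qed

lemmas poly_arrangement_counts_grid = poly_char_poly_counts_grid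

end

section \<open>The characteristic polynomial as a sum over paths\<close>

lemma poly_arrangement_char_poly:
  assumes k: "k \<ge> 1" and m: "m \<ge> 1" and S: "unity_closed m S"
  shows "poly (arrangement_char_poly (Suc N) k m) (int (card S)) =
    (\<Sum>r\<le>N. path_weight k m (int (card S)) N r * (int (card S) - int (r * m + 1)) ^ k)"
proof -
  have "card S > 0" using S by (auto simp: unity_closed_def card_gt_0_iff)
  then show ?thesis
    using poly_arrangement_counts_grid[OF m S, of "Suc N" k] card_grid_centre[OF m _ k S, of "Suc N"]
    unfolding card_grid_complement[OF m S] total_weighted_count[OF m S] arrangement_char_poly_def
    by simp
qed

text \<open>
  Closed sets of size \<open>1 + s m\<close> exist for all \<open>s\<close>, so two polynomials are compared at infinitely many
  integers.
\<close>

lemma arrangement_char_poly_eq: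
  assumes k: "k \<ge> 1" and m: "m \<ge> 1"
  shows "arrangement_char_poly (Suc N) k m =
    (\<Sum>r\<le>N. path_weight k m [:0, 1:] N r * ([:0, 1:] - of_nat (r * m + 1)) ^ k)" (is "?A = ?B")
proof -
  have "poly (?A - ?B) (int (1 + s * m)) = 0" for s
  proof -
    obtain S where "unity_closed m S" "card S = 1 + s * m" using ex_unity_closed[OF m] by blast
    then show ?thesis
      using poly_arrangement_char_poly[OF k m, of S N] by (simp add: poly_sum poly_path_weight)
  qed
  then have "range (\<lambda>s. int (1 + s * m)) \<subseteq> {x. poly (?A - ?B) x = 0}" by auto
  moreover have "infinite (range (\<lambda>s. int (1 + s * m)))"
    using m by (intro range_inj_infinite injI) simp
  ultimately have "?A - ?B = 0" using poly_roots_finite[of "?A - ?B"] finite_subset by blast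
  then show ?thesis by simp
qed

section \<open>The generating function\<close>

text \<open>
  A path that ends at level \<open>r\<close> makes one upward step from each lower level, which gives the numerator,
  and any number of stationary steps at each of the levels \<open>0, \<dots>, r\<close>, which gives the geometric series
  in the denominator.
\<close>

definition path_gf :: "nat \<Rightarrow> nat \<Rightarrow> nat \<Rightarrow> int poly fps" where
  "path_gf k m r = fps_const ((\<Prod>i<r. [:0, 1:] - of_nat (i * m + 1)) ^ Suc k) * fps_X ^ r *
    fps_right_inverse (rhs_denominator (Suc r) k m) 1"

text \<open>
  With \<open>c\<^sub>i = i m + 1\<close>, the numerator contains the factor \<open>t - c\<^sub>i\<close> with exponent \<open>k + 1\<close> for \<open>i < r\<close>, as in a path with
  \<open>r\<close> upward steps, and with exponent \<open>k\<close> for \<open>i = r\<close>.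
\<close>

lemma rhs_term_eq:
  "rhs_numerator (Suc r) k m * fps_right_inverse (rhs_denominator (Suc r) k m) 1 =
    fps_const (([:0, 1:] - of_nat (r * m + 1)) ^ k) * path_gf k m r"
proof -
  have sf: "step_falling ([:0, 1:] - 1) r m = (\<Prod>i<r. [:0, 1:] - of_nat (i * m + 1) :: int poly)" for r
    unfolding step_falling_def by (rule prod.cong) (simp_all add: algebra_simps)
  have "step_falling ([:0, 1:] - 1) r m * step_falling ([:0, 1:] - 1) (Suc r) m ^ k =
      ([:0, 1:] - of_nat (r * m + 1)) ^ k * (\<Prod>i<r. [:0, 1:] - of_nat (i * m + 1) :: int poly) ^ Suc k"
    unfolding sf prod.lessThan_Suc power_mult_distrib by (simp only: power_Suc mult_ac)
  then show ?thesis
    unfolding rhs_numerator_def path_gf_def diff_Suc_1 by (simp only: fps_const_mult[symmetric] mult.assoc)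
qed

text \<open>
  Multiplying by the factor of level \<open>r\<close> removes the stationary steps at that level; what is left is a
  path to level \<open>r - 1\<close> followed by one upward step.
\<close>

lemma path_gf_rec:
  "path_gf k m r * (1 - fps_const (of_nat (r * m + 1) * ([:0, 1:] - of_nat (r * m + 1)) ^ k) * fps_X) =
    (case r of 0 \<Rightarrow> 1
     | Suc s \<Rightarrow> fps_const (([:0, 1:] - of_nat (s * m + 1)) ^ Suc k) * fps_X * path_gf k m s)"
proof (cases r)
  case 0
  then show ?thesis
    using rhs_denominator_inverse[of 1 k m] by (simp add: path_gf_def rhs_denominator_def mult.commute)
next
  case (Suc s)
  let ?f = "1 - fps_const (of_nat (r * m + 1) * ([:0, 1:] - of_nat (r * m + 1)) ^ k) * fps_X :: int poly fps"
  let ?inv = "\<lambda>n. fps_right_inverse (rhs_denominator n k m) 1"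
  have peel: "fps_const ((P * v) ^ Suc k) * fps_X ^ Suc s * I =
      fps_const (v ^ Suc k) * fps_X * (fps_const (P ^ Suc k) * fps_X ^ s * I)"
    for P v :: "int poly" and I
    by (simp only: power_mult_distrib power_Suc[of fps_X] fps_const_mult[symmetric] mult_ac)
  have den: "rhs_denominator (Suc r) k m = rhs_denominator (Suc s) k m * ?f"
    by (simp only: rhs_denominator_def Suc diff_Suc_1 prod.atLeast0_atMost_Suc)
  have cancel: "J * f = I" if "D * f * J = 1" "D * I = 1" for D f I J :: "int poly fps"
  proof -
    have "J * f = J * f * (D * I)" using that(2) by simp
    also have "\<dots> = D * f * J * I" by (simp only: mult_ac)
    finally show ?thesis using that(1) by simp
  qed
  have inv: "?inv (Suc r) * ?f = ?inv (Suc s)"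
    by (rule cancel[OF _ rhs_denominator_inverse], unfold den[symmetric], rule rhs_denominator_inverse)
  have "path_gf k m r * ?f = fps_const ((\<Prod>i<r. [:0, 1:] - of_nat (i * m + 1)) ^ Suc k) * fps_X ^ r * ?inv (Suc s)"
    unfolding path_gf_def mult.assoc inv ..
  also have "\<dots> = fps_const (([:0, 1:] - of_nat (s * m + 1)) ^ Suc k) * fps_X * path_gf k m s"
    unfolding path_gf_def Suc prod.lessThan_Suc by (rule peel)
  finally show ?thesis by (simp only: Suc nat.case)
qed

lemma fps_nth_path_gf: "fps_nth (path_gf k m r) N = path_weight k m [:0, 1:] N r"
proof (induction N arbitrary: r)
  case 0
  have "fps_nth (path_gf k m r * (1 - fps_const c * fps_X)) 0 = fps_nth (path_gf k m r) 0" for c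
    by simp
  then show ?case
    using arg_cong[OF path_gf_rec[of k m r], of "\<lambda>f. fps_nth f 0"] by (simp split: nat.splits)
next
  case (Suc N)
  let ?c = "of_nat (r * m + 1) * ([:0, 1:] - of_nat (r * m + 1)) ^ k :: int poly"
  have "fps_nth (g * (1 - fps_const c * fps_X)) (Suc N) = fps_nth g (Suc N) - c * fps_nth g N"
    for g and c :: "int poly"
  proof -
    have "g * (1 - fps_const c * fps_X) = g - fps_const c * (g * fps_X)"
      by (simp only: right_diff_distrib mult_1_right mult.left_commute[of g "fps_const c"])
    then show ?thesis by simp
  qed
  note step = this[of "path_gf k m r" ?c]
  have solve: "a = b + d" if "d = a - b" for a b d :: "int poly"
    using that by simp
  from step
  have eq: "fps_nth (path_gf k m r) (Suc N) = ?c * fps_nth (path_gf k m r) N +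
      fps_nth (case r of 0 \<Rightarrow> 1
        | Suc s \<Rightarrow> fps_const (([:0, 1:] - of_nat (s * m + 1)) ^ Suc k) * fps_X * path_gf k m s) (Suc N)"
    unfolding path_gf_rec by (rule solve)
  have shift: "fps_nth (fps_const v * fps_X * g) (Suc N) = v * fps_nth g N" for v :: "int poly" and g
    by (simp add: mult.assoc)
  have "fps_nth (case r of 0 \<Rightarrow> 1
      | Suc s \<Rightarrow> fps_const (([:0, 1:] - of_nat (s * m + 1)) ^ Suc k) * fps_X * path_gf k m s) (Suc N) =
      (if r = 0 then 0
       else ([:0, 1:] - of_nat ((r - 1) * m + 1)) ^ Suc k * fps_nth (path_gf k m (r - 1)) N)"
  proof (cases r)
    case 0
    then show ?thesis by simp
  next
    case (Suc s)
    then show ?thesis by (simp only: nat.case shift diff_Suc_1 nat.distinct if_False)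
  qed
  then show ?case unfolding path_weight.simps Suc[symmetric] eq by (simp only:)
qed

theorem theorem5p4:
  fixes k m :: nat
  assumes "k \<ge> 1" and "m \<ge> 1"
  shows "(\<lambda>n. rhs_numerator (Suc n) k m * fps_right_inverse (rhs_denominator (Suc n) k m) 1)
           sums Abs_fps (\<lambda>n. arrangement_char_poly (Suc n) k m)"
  unfolding sums_def
proof (rule tendsto_fpsI)
  fix N
  let ?w = "\<lambda>r. path_weight k m [:0, 1:] N r * ([:0, 1:] - of_nat (r * m + 1)) ^ k :: int poly"
  show "eventually (\<lambda>b. fps_nth (\<Sum>n<b. rhs_numerator (Suc n) k m *
      fps_right_inverse (rhs_denominator (Suc n) k m) 1) N =
      fps_nth (Abs_fps (\<lambda>n. arrangement_char_poly (Suc n) k m)) N) sequentially"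
    using eventually_gt_at_top[of N]
  proof eventually_elim
    case (elim b)
    have "fps_nth (\<Sum>n<b. rhs_numerator (Suc n) k m *
        fps_right_inverse (rhs_denominator (Suc n) k m) 1) N = (\<Sum>r<b. ?w r)"
      unfolding fps_sum_nth rhs_term_eq fps_mult_left_const_nth fps_nth_path_gf
      by (rule sum.cong) (simp_all only: mult.commute)
    also have "\<dots> = (\<Sum>r\<le>N. ?w r)"
      (* paths of N steps do not reach levels above N *)
      using elim by (intro sum.mono_neutral_right) (auto simp: path_weight_eq_0)
    also have "\<dots> = fps_nth (Abs_fps (\<lambda>n. arrangement_char_poly (Suc n) k m)) N"
      by (simp only: arrangement_char_poly_eq[OF assms] fps_nth_Abs_fps)
    finally show ?case .
  qed
qed

end
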